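(* Let $N=N_\varphi\oplus\mathbb{Z}$ with $N_\varphi\simeq\mathbb{Z}^2$, let $\nabla^\varphi\subset N_{\varphi,\mathbb{R}}$ be a $2$-dimensional reflexive polytope, and let $\nabla^{s}\subset N_{\mathbb{R}}$ be a semistable polytope with fiber $\nabla^\varphi$ and segment $L$ centered at the vertex $v_z$ of $\nabla^\varphi$. Let $\Delta^s\subset M_{\mathbb{R}}$ be the dual of $\nabla^s$ and $\Delta^\varphi\subset M_{\mathbb{R}}$ the dual of $\nabla^\varphi$ (viewed in $M_{\mathbb{R}}$ via the splitting). Assume that $\Delta\subset\Delta^s$ is a reflexive subpolytope which contains $\Delta^\varphi$. Then: (a) the dual $\nabla$ of $\Delta$ contains $\nabla^s$ (so the hypotheses under which a general anticanonical $K3$ hypersurface is birational to a Candelas-Font Weierstrass model in the toric variety $X^s$ of $\nabla^s$ are satisfied); (b) the projective resolution of the corresponding $K3$ surface (the general anticanonical hypersurface of a projective subdivision of the normal fan of $\Delta$) has a section at infinity. Moreover, the condition that $\nabla$ projects onto $\nabla^\varphi$ together with the existence of a section at infinity characterizes the polytopes of Candelas' algorithm: a reflexive polytope $\nabla\subset N_{\mathbb{R}}$ containing $\nabla^\varphi$ satisfies Candelas' conditions 1), 2), 3) if and only if the projection $N=N_\varphi\oplus\mathbb{Z}\to N_\varphi$ maps $\nabla$ onto $\nabla^\varphi$ and the associated elliptic $K3$ has a section at infinity.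
   Context: $M$ is the lattice dual to $N$, with induced splitting and coordinates $(z_1^*,z_2^*,z_3^* )$; $\Delta^\varphi$ is placed in $M_{\mathbb{R}}$ inside the plane $z_3^*=0$. A lattice polytope containing the origin in its interior is reflexive if its dual $\{m:\langle m,v\rangle\ge-1\ \forall v\}$ is a lattice polytope. Semistable polytope: let $v_z$ be a vertex of $\nabla^\varphi$, and $L$ a segment whose lattice points are exactly its endpoints $v_s,v_t$ and its midpoint $v_z$, such that $v_s,v_t$ and the vertices of $\nabla^\varphi$ generate $N_{\mathbb{R}}$. If the convex hull $\nabla^s$ of $\nabla^\varphi$ and $L$ is reflexive it is a semistable polytope with fiber $\nabla^\varphi$. $X^s$ is the simplicial toric variety of the fan with simplicial cones over the vertices of $\nabla^\varphi$, $v_s$, $v_t$. A Candelas-Font Weierstrass model is an elliptically fibered $K3$ surface $W\to\mathbb{P}^1$ with orbifold Gorenstein singularities, anticanonical in $X^s$ (not necessarily general), with general fiber an anticanonical curve in the toric surface of the fan over the faces of $\nabla^\varphi$ and with a section at infinity given by the toric divisor of $v_z$. Section at infinity: for a reflexive $\nabla\supset\nabla^\varphi$ with $\nabla\cap N_{\varphi,\mathbb{R}}=\nabla^\varphi$, consider a projective simplicial refinement of the fan over the faces of $\nabla$ with its toric fibration to $\mathbb{P}^1$ induced by $N\to N/N_\varphi$. Let $v_z$ be a vertex of $\nabla^\varphi$ with Cox coordinate $z$ and let $s,t$ be the Cox coordinates of the lattice neighbors $v_s,v_t$ of $v_z$ along edges of $\nabla$ through $v_z$ lying on the two sides of $N_{\varphi,\mathbb{R}}$.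 The toric divisor $D_z=\{z=0\}$ is a section at infinity if the restriction to $z=0$ of the equation of the general anticanonical surface does not depend on $s,t$; equivalently, $v_z$ is an interior point of an edge of $\nabla$ containing $v_s,v_t$. Candelas' conditions (all up to an automorphism of the lattice $N$): 1) $N_\varphi\subset N$ is a summand, with induced surjection $N\to N_\varphi$, $(z_1,z_2,z_3)\mapsto(z_1,z_2)$; 2) under this morphism the lattice points of $\nabla$ are sent onto points of $\nabla^\varphi$; 3) there exists a vertex $v_z=(a,b,0)$ of $\nabla^\varphi$ which is not a vertex of $\nabla$. *)

theory Defs
  imports "HOL-Analysis.Analysis"
begin

text \<open>
  Conventions. \<open>N\<^sub>\<phi> = \<int>\<^sup>2\<close> sits in \<open>real^2\<close>, and \<open>N = N\<^sub>\<phi> \<oplus> \<int>\<close> sits in \<open>(real^2) \<times> real\<close>: the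
  projection \<open>(z\<^sub>1,z\<^sub>2,z\<^sub>3) \<mapsto> (z\<^sub>1,z\<^sub>2)\<close> is \<open>fst\<close>, and \<open>N \<rightarrow> N/N\<^sub>\<phi>\<close> is \<open>snd\<close>.  The dual lattice \<open>M\<close>
  is identified with \<open>N\<close> by the standard inner product, which is the pairing.
\<close>

subsection \<open>Lattice polytopes\<close>

definition int_lattice :: "'a::euclidean_space set" where
  "int_lattice = {x. \<forall>b\<in>Basis. x \<bullet> b \<in> \<int>}"

definition lattice_polytope :: "'a::euclidean_space set \<Rightarrow> bool" where
  "lattice_polytope P \<longleftrightarrow> (\<exists>V. finite V \<and> V \<subseteq> int_lattice \<and> P = convex hull V)"

definition dual_polytope :: "'a::euclidean_space set \<Rightarrow> 'a set" where
  "dual_polytope P = {m. \<forall>v\<in>P. m \<bullet> v \<ge> -1}"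

definition reflexive_polytope :: "'a::euclidean_space set \<Rightarrow> bool" where
  "reflexive_polytope P \<longleftrightarrow>
     lattice_polytope P \<and> 0 \<in> interior P \<and> lattice_polytope (dual_polytope P)"

definition in_plane :: "(real^2) set \<Rightarrow> ((real^2) \<times> real) set" where
  "in_plane A = A \<times> {0}"

text \<open>\<open>P\<close> is the semistable polytope with fiber \<open>Q\<close> and segment \<open>L\<close> from \<open>s\<close> to \<open>t\<close> centered at \<open>z\<close>.\<close>

definition semistable_polytope ::
  "(real^2) set \<Rightarrow> real^2 \<Rightarrow> (real^2) \<times> real \<Rightarrow> (real^2) \<times> real \<Rightarrow> ((real^2) \<times> real) set \<Rightarrow> bool" where
  "semistable_polytope Q z s t P \<longleftrightarrow>
     z extreme_point_of Q \<and>
     closed_segment s t \<inter> int_lattice = {s, (z, 0), t} \<and>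
     (z, 0) = midpoint s t \<and>
     span ({s, t} \<union> in_plane {v. v extreme_point_of Q}) = UNIV \<and>
     P = convex hull (in_plane Q \<union> closed_segment s t) \<and>
     reflexive_polytope P"

subsection \<open>Toric fans\<close>

definition face_fan :: "'a::euclidean_space set \<Rightarrow> 'a set set" where
  "face_fan P = {convex_cone hull F | F. F face_of P \<and> F \<noteq> P}"

definition simplicial_fan :: "'a::euclidean_space set set \<Rightarrow> bool" where
  "simplicial_fan \<Sigma> \<longleftrightarrow>
     finite \<Sigma> \<and>
     (\<forall>\<sigma>\<in>\<Sigma>. \<exists>B. finite B \<and> B \<subseteq> int_lattice \<and> independent B \<and> \<sigma> = convex_cone hull B) \<and>
     (\<forall>\<sigma>\<in>\<Sigma>. \<forall>\<tau>. \<tau> face_of \<sigma> \<and> \<tau> \<noteq> {} \<longrightarrow> \<tau> \<in> \<Sigma>) \<and>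
     (\<forall>\<sigma>\<in>\<Sigma>. \<forall>\<tau>\<in>\<Sigma>. (\<sigma> \<inter> \<tau>) face_of \<sigma>)"

definition refines_fan :: "'a::euclidean_space set set \<Rightarrow> 'a set set \<Rightarrow> bool" where
  "refines_fan \<Sigma> \<Sigma>' \<longleftrightarrow> \<Union>\<Sigma> = \<Union>\<Sigma>' \<and> (\<forall>\<sigma>\<in>\<Sigma>. \<exists>\<sigma>'\<in>\<Sigma>'. \<sigma> \<subseteq> \<sigma>')"

text \<open>
  For complete fans: \<open>\<psi>\<close> is an integral support function, strictly convex with respect to \<open>\<Sigma>\<close>, i.e.
  it defines an ample torus-invariant Cartier divisor.
\<close>

definition projective_fan :: "'a::euclidean_space set set \<Rightarrow> bool" where
  "projective_fan \<Sigma> \<longleftrightarrow>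
     (\<exists>\<psi> :: 'a \<Rightarrow> real. \<forall>\<sigma>\<in>\<Sigma>. aff_dim \<sigma> = int DIM('a) \<longrightarrow>
        (\<exists>u\<in>int_lattice. \<forall>x. u \<bullet> x \<le> \<psi> x \<and> (u \<bullet> x = \<psi> x \<longleftrightarrow> x \<in> \<sigma>)))"

text \<open>Rays are represented by their primitive lattice generators; they index the Cox coordinates.\<close>

definition fan_rays :: "'a::euclidean_space set set \<Rightarrow> 'a set" where
  "fan_rays \<Sigma> =
     {v. v \<noteq> 0 \<and> closed_segment 0 v \<inter> int_lattice = {0, v} \<and> convex_cone hull {v} \<in> \<Sigma>}"

text \<open>
  A projective simplicial refinement of the fan over the faces of \<open>P\<close> that is crepant (no new ray
  leaves \<open>P\<close>, so that anticanonical sections pull back to anticanonical sections) and on which \<open>snd\<close>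
  is a map of fans to the fan of \<open>\<P>\<^sup>1\<close>.
\<close>

definition fibered_refinement ::
  "((real^2) \<times> real) set \<Rightarrow> ((real^2) \<times> real) set set \<Rightarrow> bool" where
  "fibered_refinement P \<Sigma> \<longleftrightarrow>
     simplicial_fan \<Sigma> \<and> refines_fan \<Sigma> (face_fan P) \<and> projective_fan \<Sigma> \<and>
     fan_rays \<Sigma> \<subseteq> P \<and>
     (\<forall>\<sigma>\<in>\<Sigma>. \<exists>\<tau>\<in>{{0}, {0..}, {..0}}. snd ` \<sigma> \<subseteq> \<tau>)"

text \<open>
  The general anticanonical surface is smooth iff all lattice points on the edges of \<open>P\<close> are rays:
  the divisors of lattice points interior to facets do not meet it.
\<close>

definition fibered_resolution ::
  "((real^2) \<times> real) set \<Rightarrow> ((real^2) \<times> real) set set \<Rightarrow> bool" where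
  "fibered_resolution P \<Sigma> \<longleftrightarrow>
     fibered_refinement P \<Sigma> \<and> (\<forall>e. e edge_of P \<longrightarrow> e \<inter> int_lattice \<subseteq> fan_rays \<Sigma>)"

subsection \<open>The general anticanonical surface in Cox coordinates\<close>

definition anticanonical_exponents :: "'a::euclidean_space set set \<Rightarrow> 'a set" where
  "anticanonical_exponents \<Sigma> = {m \<in> int_lattice. \<forall>v\<in>fan_rays \<Sigma>. m \<bullet> v \<ge> -1}"

definition anticanonical_eqn ::
  "'a::euclidean_space set set \<Rightarrow> ('a \<Rightarrow> complex) \<Rightarrow> ('a \<Rightarrow> complex) \<Rightarrow> complex" where
  "anticanonical_eqn \<Sigma> c x =
     (\<Sum>m\<in>anticanonical_exponents \<Sigma>. c m * (\<Prod>v\<in>fan_rays \<Sigma>. x v ^ nat \<lfloor>m \<bullet> v + 1\<rfloor>))"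

inductive_set poly_functions :: "'i set \<Rightarrow> (('i \<Rightarrow> complex) \<Rightarrow> complex) set" for I :: "'i set" where
  const: "(\<lambda>_. a) \<in> poly_functions I"
| coord: "i \<in> I \<Longrightarrow> (\<lambda>c. c i) \<in> poly_functions I"
| add: "p \<in> poly_functions I \<Longrightarrow> q \<in> poly_functions I \<Longrightarrow> (\<lambda>c. p c + q c) \<in> poly_functions I"
| mult: "p \<in> poly_functions I \<Longrightarrow> q \<in> poly_functions I \<Longrightarrow> (\<lambda>c. p c * q c) \<in> poly_functions I"

text \<open>\<open>\<Phi>\<close> holds on a nonempty Zariski-open subset of the affine space of coefficients indexed by \<open>I\<close>.\<close>

definition for_general :: "'i set \<Rightarrow> (('i \<Rightarrow> complex) \<Rightarrow> bool) \<Rightarrow> bool" where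
  "for_general I \<Phi> \<longleftrightarrow>
     (\<exists>q\<in>poly_functions I. (\<exists>c. q c \<noteq> 0) \<and> (\<forall>c. q c \<noteq> 0 \<longrightarrow> \<Phi> c))"

definition restriction_independent_of ::
  "(('i \<Rightarrow> complex) \<Rightarrow> complex) \<Rightarrow> 'i \<Rightarrow> 'i \<Rightarrow> 'i \<Rightarrow> bool" where
  "restriction_independent_of f z s t \<longleftrightarrow>
     (\<forall>x y. x z = 0 \<and> y z = 0 \<and> (\<forall>v. v \<noteq> s \<and> v \<noteq> t \<longrightarrow> x v = y v) \<longrightarrow> f x = f y)"

subsection \<open>Sections at infinity\<close>

definition lattice_neighbor :: "'a::euclidean_space set \<Rightarrow> 'a \<Rightarrow> 'a \<Rightarrow> bool" where
  "lattice_neighbor P z w \<longleftrightarrow>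
     w \<noteq> z \<and> closed_segment z w \<inter> int_lattice = {z, w} \<and> (\<exists>e. e edge_of P \<and> z \<in> e \<and> w \<in> e)"

definition section_at_infinity ::
  "(real^2) set \<Rightarrow> ((real^2) \<times> real) set \<Rightarrow> ((real^2) \<times> real) set set \<Rightarrow> real^2 \<Rightarrow> bool" where
  "section_at_infinity Q P \<Sigma> z \<longleftrightarrow>
     reflexive_polytope P \<and> P \<inter> in_plane UNIV = in_plane Q \<and> fibered_refinement P \<Sigma> \<and>
     z extreme_point_of Q \<and>
     (\<exists>s t. {(z, 0), s, t} \<subseteq> fan_rays \<Sigma> \<and>
        lattice_neighbor P (z, 0) s \<and> snd s > 0 \<and>
        lattice_neighbor P (z, 0) t \<and> snd t < 0 \<and>
        for_general (anticanonical_exponents \<Sigma>)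
          (\<lambda>c. restriction_independent_of (anticanonical_eqn \<Sigma> c) (z, 0) s t))"

definition has_section_at_infinity ::
  "(real^2) set \<Rightarrow> ((real^2) \<times> real) set \<Rightarrow> ((real^2) \<times> real) set set \<Rightarrow> bool" where
  "has_section_at_infinity Q P \<Sigma> \<longleftrightarrow> (\<exists>z. section_at_infinity Q P \<Sigma> z)"

subsection \<open>Candelas' conditions\<close>

text \<open>
  Conditions 2) and 3) in given coordinates; condition 1), that \<open>N\<^sub>\<phi>\<close> is the summand \<open>z\<^sub>3 = 0\<close> and the
  surjection is \<open>fst\<close>, is built into the ambient space.
\<close>

definition candelas_conditions :: "(real^2) set \<Rightarrow> ((real^2) \<times> real) set \<Rightarrow> bool" where
  "candelas_conditions Q P \<longleftrightarrow>
     fst ` (P \<inter> int_lattice) = Q \<inter> int_lattice \<and>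
     (\<exists>z. z extreme_point_of Q \<and> \<not> (z, 0) extreme_point_of P)"

text \<open>
  \<open>(Q', P')\<close> is \<open>(Q, P)\<close> in the coordinates given by an automorphism of \<open>N\<close> for which \<open>N\<^sub>\<phi>\<close> is again
  the summand \<open>z\<^sub>3 = 0\<close>, as required by condition 1).  It may change the complement of \<open>N\<^sub>\<phi>\<close>, hence the
  projection to \<open>N\<^sub>\<phi>\<close>.
\<close>

definition lattice_equivalent ::
  "(real^2) set \<Rightarrow> ((real^2) \<times> real) set \<Rightarrow> (real^2) set \<Rightarrow> ((real^2) \<times> real) set \<Rightarrow> bool" where
  "lattice_equivalent Q P Q' P' \<longleftrightarrow>
     (\<exists>g. linear g \<and> bij g \<and> g ` int_lattice = int_lattice \<and>
        g ` in_plane int_lattice = in_plane int_lattice \<and>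
        g ` in_plane Q = in_plane Q' \<and> g ` P = P')"

definition candelas_up_to_automorphism :: "(real^2) set \<Rightarrow> ((real^2) \<times> real) set \<Rightarrow> bool" where
  "candelas_up_to_automorphism Q P \<longleftrightarrow>
     (\<exists>Q' P'. lattice_equivalent Q P Q' P' \<and> candelas_conditions Q' P')"

definition projects_up_to_automorphism :: "(real^2) set \<Rightarrow> ((real^2) \<times> real) set \<Rightarrow> bool" where
  "projects_up_to_automorphism Q P \<longleftrightarrow>
     (\<exists>Q' P'. lattice_equivalent Q P Q' P' \<and> fst ` P' = Q')"

end

theory Submission
  imports Defs
begin

text \<open>
  A section at infinity exists precisely when \<open>P\<close> meets the plane \<open>z\<^sub>3 = 0\<close> in the fiber polytope \<open>Q\<close>
  and some vertex \<open>z\<close> of \<open>Q\<close> is not a vertex of \<open>P\<close>.  If \<open>(z, 0)\<close> is not a vertex of \<open>P\<close>, it is interior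
  to a segment in \<open>P\<close> crossing the plane, and since \<open>z\<close> is a vertex of the slice, that segment spans an
  edge; a monomial \<open>m\<close> not involving the coordinate of \<open>(z, 0)\<close> attains its minimum \<open>-1\<close> there, hence on
  the whole edge, so it involves neither neighbor.  If \<open>(z, 0)\<close> is a vertex, then by reflexivity some
  lattice point of the dual equals \<open>-1\<close> at \<open>(z, 0)\<close> but not at \<open>s\<close>.  This criterion is invariant under
  automorphisms of \<open>N\<close> preserving \<open>N\<^sub>\<phi>\<close>; together with the fact that lattice polytopes are the hulls of
  their lattice points it gives the characterization by Candelas' conditions, and it holds for the dual
  of \<open>\<Delta>\<close> because \<open>(z, 0)\<close> is the midpoint of \<open>L\<close>.
\<close>

section \<open>Lattice points and lattice polytopes\<close>

lemma int_lattice_Pair [simp]: "(x, y) \<in> int_lattice \<longleftrightarrow> x \<in> int_lattice \<and> y \<in> \<int>"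
  for y :: real
  by (auto simp: int_lattice_def Basis_prod_def)

lemma inner_int_lattice:
  assumes "m \<in> int_lattice" "v \<in> int_lattice"
  shows "m \<bullet> v \<in> \<int>"
  using assms unfolding int_lattice_def euclidean_inner[of m v] by (auto intro!: Ints_sum)

lemma uniform_discrete_int_lattice: "uniform_discrete int_lattice"
proof (rule uniformI1[where e = 1])
  fix x y :: 'a
  assume xy: "x \<in> int_lattice" "y \<in> int_lattice" "dist x y < 1"
  have "x \<bullet> b = y \<bullet> b" if b: "b \<in> Basis" for b
  proof -
    have "\<bar>x \<bullet> b - y \<bullet> b\<bar> \<le> dist x y"
      by (metis Basis_le_norm b dist_norm inner_diff_left)
    moreover have "x \<bullet> b - y \<bullet> b \<in> \<int>"
      using xy b by (auto simp: int_lattice_def)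
    ultimately show ?thesis
      using xy Ints_nonzero_abs_less1[of "x \<bullet> b - y \<bullet> b"] by auto
  qed
  then show "x = y"
    by (rule euclidean_eqI)
qed simp

text \<open>Supplies the finiteness of the sets of rays and of anticanonical monomials.\<close>

lemma finite_bounded_Int_int_lattice:
  fixes S :: "'a::euclidean_space set"
  assumes "bounded S"
  shows "finite (S \<inter> int_lattice)"
proof -
  have "uniform_discrete (S \<inter> int_lattice)"
    using uniform_discrete_int_lattice by (auto simp: uniform_discrete_def)
  then show ?thesis
    using assms uniform_discrete_finite_iff bounded_Int by blast
qed

lemma lattice_polytope_imp_polytope: "lattice_polytope P \<Longrightarrow> polytope P"
  by (auto simp: lattice_polytope_def polytope_def)

text \<open>Lets statements about lattice points be passed on to the whole polytope.\<close>

lemma lattice_polytope_eq_hull: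
  assumes "lattice_polytope P"
  shows "P = convex hull (P \<inter> int_lattice)"
proof -
  obtain V where V: "V \<subseteq> int_lattice" "P = convex hull V"
    using assms by (auto simp: lattice_polytope_def)
  then have "V \<subseteq> P \<inter> int_lattice"
    by (simp add: hull_subset)
  then have "P \<subseteq> convex hull (P \<inter> int_lattice)"
    using V hull_mono by blast
  moreover have "convex hull (P \<inter> int_lattice) \<subseteq> P"
    by (rule hull_minimal) (auto simp: V)
  ultimately show ?thesis by blast
qed

lemma extreme_point_of_lattice_polytope:
  assumes "lattice_polytope P" "x extreme_point_of P"
  shows "x \<in> int_lattice"
  using assms extreme_point_of_convex_hull unfolding lattice_polytope_def by blast

lemma lattice_polytope_face_of:
  assumes "lattice_polytope P" "F face_of P"
  shows "lattice_polytope F"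
  using assms unfolding lattice_polytope_def
  by (metis face_of_convex_hull_subset finite_imp_compact finite_subset subset_trans)

lemma lattice_polytope_linear_image:
  assumes "lattice_polytope P" "linear g" "g ` int_lattice \<subseteq> int_lattice"
  shows "lattice_polytope (g ` P)"
  using assms unfolding lattice_polytope_def
  by (metis convex_hull_linear_image finite_imageI image_mono subset_trans)

section \<open>Polar duality and reflexivity\<close>

text \<open>The bipolar theorem. A hyperplane strictly separating a point from \<open>P\<close> has
  negative level because \<open>0 \<in> P\<close>, so it can be rescaled to level -1, where its
  normal belongs to the dual.\<close>

lemma dual_dual_polytope:
  fixes P :: "'a::euclidean_space set"
  assumes "closed P" "convex P" "0 \<in> P"
  shows "dual_polytope (dual_polytope P) = P"
proof
  show "P \<subseteq> dual_polytope (dual_polytope P)"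
    by (auto simp: dual_polytope_def inner_commute)
  show "dual_polytope (dual_polytope P) \<subseteq> P"
  proof (rule subsetI, rule ccontr)
    fix x assume x: "x \<in> dual_polytope (dual_polytope P)" "x \<notin> P"
    then obtain a b where ab: "a \<bullet> x < b" "\<And>y. y \<in> P \<Longrightarrow> a \<bullet> y > b"
      using separating_hyperplane_closed_point[OF assms(2,1), of x] by blast
    then have b: "b < 0"
      using assms(3) by force
    let ?m = "(1 / (-b)) *\<^sub>R a"
    have "?m \<in> dual_polytope P"
      using ab(2) b by (fastforce simp: dual_polytope_def field_simps)
    then have "x \<bullet> ?m \<ge> -1"
      using x(1) unfolding dual_polytope_def[of "dual_polytope P"] by blast
    then show False
      using ab(1) b by (simp add: inner_commute field_simps)
  qed
qed

text \<open>By Cauchy-Schwarz, a bound \<open>B\<close> on the norms in \<open>P\<close> puts the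
  ball of radius \<open>1 / B\<close> into the dual.\<close>

lemma zero_in_interior_dual_polytope:
  assumes "bounded P"
  shows "0 \<in> interior (dual_polytope P)"
proof -
  obtain B where B: "B > 0" "\<And>v. v \<in> P \<Longrightarrow> norm v \<le> B"
    using assms bounded_pos by blast
  have "ball 0 (1 / B) \<subseteq> dual_polytope P"
  proof
    fix m :: 'a assume m: "m \<in> ball 0 (1 / B)"
    have "m \<bullet> v \<ge> -1" if "v \<in> P" for v
    proof -
      have "\<bar>m \<bullet> v\<bar> \<le> norm m * norm v"
        by (rule Cauchy_Schwarz_ineq2)
      also have "\<dots> \<le> (1 / B) * B"
        using m B that by (intro mult_mono) auto
      finally show ?thesis using B by simp
    qed
    then show "m \<in> dual_polytope P"
      by (simp add: dual_polytope_def)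
  qed
  then show ?thesis
    using B by (meson centre_in_ball interiorI open_ball zero_less_divide_1_iff)
qed

lemma reflexive_polytope_dual_dual:
  assumes "reflexive_polytope P"
  shows "dual_polytope (dual_polytope P) = P"
  using assms unfolding reflexive_polytope_def
  by (meson dual_dual_polytope interior_subset lattice_polytope_imp_polytope
      polytope_imp_closed polytope_imp_convex subsetD)

lemma reflexive_polytope_dual:
  assumes "reflexive_polytope P"
  shows "reflexive_polytope (dual_polytope P)"
  using assms reflexive_polytope_dual_dual[OF assms] unfolding reflexive_polytope_def
  by (metis lattice_polytope_imp_polytope polytope_imp_bounded zero_in_interior_dual_polytope)

section \<open>Extreme points, edges and lattice neighbors\<close>

text \<open>A nonzero \<open>v\<close> would place \<open>z\<close> strictly between the two given
  points of \<open>Q\<close>.\<close>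

lemma extreme_point_opposite_directions:
  fixes z :: "'a::euclidean_space"
  assumes "z extreme_point_of Q" "z + a *\<^sub>R v \<in> Q" "z - b *\<^sub>R v \<in> Q" "a > 0" "b > 0"
  shows "v = 0"
proof (rule ccontr)
  assume v: "v \<noteq> 0"
  let ?u = "a / (a + b)"
  have "z = (1 - ?u) *\<^sub>R (z + a *\<^sub>R v) + ?u *\<^sub>R (z - b *\<^sub>R v)"
  proof -
    have "(1 - ?u) * a - ?u * b = 0"
      using assms by (simp add: field_simps)
    moreover have "(1 - ?u) *\<^sub>R (z + a *\<^sub>R v) + ?u *\<^sub>R (z - b *\<^sub>R v) = z + ((1 - ?u) * a - ?u * b) *\<^sub>R v"
      by (simp add: algebra_simps)
    ultimately show ?thesis by simp
  qed
  moreover have "z + a *\<^sub>R v \<noteq> z - b *\<^sub>R v"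
  proof
    assume "z + a *\<^sub>R v = z - b *\<^sub>R v"
    then have "(a + b) *\<^sub>R v = 0"
      by (simp add: algebra_simps)
    then show False using v assms by simp
  qed
  moreover have "0 < ?u" "?u < 1"
    using assms by auto
  ultimately have "z \<in> open_segment (z + a *\<^sub>R v) (z - b *\<^sub>R v)"
    unfolding in_segment by blast
  then show False
    using assms by (meson extreme_point_of_def)
qed

lemma extreme_point_of_linear_image_iff:
  assumes "linear f" "inj f"
  shows "f x extreme_point_of f ` S \<longleftrightarrow> x extreme_point_of S"
  using face_of_linear_image[OF assms, of "{x}" S] by (simp add: face_of_singleton)

lemma extreme_point_of_in_plane [simp]:
  "(z, 0) extreme_point_of in_plane Q \<longleftrightarrow> z extreme_point_of Q"
proof -
  have "linear (\<lambda>x::real^2. (x, 0::real))"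
    by (auto intro!: linearI)
  moreover have "in_plane Q = (\<lambda>x. (x, 0)) ` Q"
    by (auto simp: in_plane_def)
  ultimately show ?thesis
    using extreme_point_of_linear_image_iff[of "\<lambda>x. (x, 0::real)" z Q] by (simp add: inj_def)
qed

text \<open>Two descents to a facet through \<open>x\<close> go from dimension 3 to 2 and then to
  1.\<close>

lemma extreme_point_on_edge:
  fixes P :: "'a::euclidean_space set"
  assumes "polytope P" "x extreme_point_of P" "aff_dim P = 3"
  obtains e where "e edge_of P" "x \<in> e"
proof -
  obtain F where F: "F facet_of P" "{x} \<subseteq> F"
    using assms face_of_polyhedron_subset_facet[of P "{x}"]
    by (metis aff_dim_sing face_of_singleton insert_not_empty polytope_imp_polyhedron zero_neq_numeral)
  then have dF: "aff_dim F = 2" and fF: "F face_of P"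
    using assms by (auto simp: facet_of_def)
  have "{x} face_of F"
    using F fF assms(2) by (metis extreme_point_of_face face_of_singleton insert_subset)
  then obtain e where e: "e facet_of F" "{x} \<subseteq> e"
    using face_of_polyhedron_subset_facet[of F "{x}"] dF fF assms(1)
    by (metis aff_dim_sing face_of_polytope_polytope insert_not_empty polytope_imp_polyhedron zero_neq_numeral)
  have "e edge_of P"
    using e dF fF by (auto simp: facet_of_def edge_of_def intro: face_of_trans)
  then show thesis using e that by blast
qed

text \<open>
  If \<open>z\<close> is a vertex of the slice \<open>Q\<close> and \<open>P\<close> contains points on both sides of \<open>(z, 0)\<close> along the
  direction \<open>(u, 1)\<close>, then a small multiple of the projection along \<open>(u, 1)\<close> of any vector pointing
  into \<open>P\<close> at \<open>(z, 0)\<close> points into \<open>Q\<close>; hence two such projections cannot be opposite.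
\<close>

lemma edge_of_through_slice_vertex:
  fixes P :: "((real^2) \<times> real) set"
  assumes P: "convex P" "P \<inter> in_plane UNIV = in_plane Q" and z: "z extreme_point_of Q"
    and s: "(z + \<sigma> *\<^sub>R u, \<sigma>) \<in> P" "\<sigma> > 0" and t: "(z + \<tau> *\<^sub>R u, \<tau>) \<in> P" "\<tau> < 0"
  shows "{p \<in> P. fst p = z + snd p *\<^sub>R u} edge_of P" (is "?e edge_of P")
proof -
  define \<pi> where "\<pi> p = fst p - snd p *\<^sub>R u - z" for p :: "(real^2) \<times> real"
  have tangent: "\<exists>\<alpha>>0. z + \<alpha> *\<^sub>R \<pi> p \<in> Q" if p: "p \<in> P" for p
  proof -
    \<comment> \<open>\<open>\<rho>\<close> is \<open>\<sigma>\<close> or \<open>\<tau>\<close>,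
      chosen so that \<open>\<rho>\<close> and \<open>snd p\<close> never have the same sign; some
      convex combination of the two points then has height 0.\<close>
    have "\<exists>\<rho>. (z + \<rho> *\<^sub>R u, \<rho>) \<in> P \<and> \<rho> \<noteq> 0 \<and> snd p / \<rho> \<le> 0"
    proof (cases "snd p \<ge> 0")
      case True
      then show ?thesis using t by (intro exI[of _ \<tau>]) (auto simp: field_simps)
    next
      case False
      then show ?thesis using s by (intro exI[of _ \<sigma>]) (auto simp: field_simps)
    qed
    then obtain \<rho> where \<rho>: "(z + \<rho> *\<^sub>R u, \<rho>) \<in> P" "\<rho> \<noteq> 0" "snd p / \<rho> \<le> 0"
      by blast
    \<comment> \<open>The weight \<open>\<alpha>\<close> on \<open>p\<close> solves
      \<open>\<alpha> * snd p + (1 - \<alpha>) * \<rho> = 0\<close>.\<close>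
    define k where "k = - (snd p / \<rho>)"
    define \<alpha> where "\<alpha> = 1 / (1 + k)"
    have k: "k \<ge> 0" "k * \<rho> = - snd p"
      using \<rho> by (auto simp: k_def)
    then have \<alpha>: "0 < \<alpha>" "\<alpha> \<le> 1" "1 - \<alpha> = \<alpha> * k"
      by (auto simp: \<alpha>_def field_simps)
    have "\<alpha> *\<^sub>R p + (1 - \<alpha>) *\<^sub>R (z + \<rho> *\<^sub>R u, \<rho>) \<in> P"
      using \<rho> \<alpha> p by (intro convexD[OF P(1)]) auto
    moreover have "(1 - \<alpha>) * \<rho> = - (\<alpha> * snd p)"
      using \<alpha> k by (metis mult.assoc mult_minus_right)
    then have "\<alpha> *\<^sub>R p + (1 - \<alpha>) *\<^sub>R (z + \<rho> *\<^sub>R u, \<rho>) = (z + \<alpha> *\<^sub>R \<pi> p, 0)"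
      by (simp add: prod_eq_iff \<pi>_def scaleR_add_right scaleR_diff_right scaleR_diff_left)
    ultimately have "(z + \<alpha> *\<^sub>R \<pi> p, 0) \<in> P \<inter> in_plane UNIV"
      by (simp add: in_plane_def)
    then show ?thesis
      using P(2) \<alpha> by (auto simp: in_plane_def)
  qed
  \<comment> \<open>\<open>\<pi>\<close> is affine and vanishes at \<open>w\<close>, so
    \<open>\<pi> b\<close> is a negative multiple of \<open>\<pi> a\<close>, while
    \<open>tangent\<close> makes both point into \<open>Q\<close> at its vertex
    \<open>z\<close>.\<close>
  have \<pi>0: "\<pi> a = 0" "\<pi> b = 0" if ab: "a \<in> P" "b \<in> P" and w: "w \<in> ?e" "w \<in> open_segment a b" for a b w
  proof -
    obtain l where l: "0 < l" "l < 1" "w = (1 - l) *\<^sub>R a + l *\<^sub>R b"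
      using w by (auto simp: in_segment)
    have "\<pi> w = (1 - l) *\<^sub>R \<pi> a + l *\<^sub>R \<pi> b"
      unfolding \<pi>_def l by (simp add: algebra_simps)
    moreover have "\<pi> w = 0"
      using w by (simp add: \<pi>_def)
    ultimately have "l *\<^sub>R \<pi> b = - ((1 - l) *\<^sub>R \<pi> a)"
      by (simp add: eq_neg_iff_add_eq_0 add.commute)
    then have "inverse l *\<^sub>R l *\<^sub>R \<pi> b = inverse l *\<^sub>R - ((1 - l) *\<^sub>R \<pi> a)"
      by simp
    then have eq: "\<pi> b = - (((1 - l) / l) *\<^sub>R \<pi> a)"
      using l by (simp add: divide_inverse_commute)
    obtain \<alpha> \<beta> where "\<alpha> > 0" "z + \<alpha> *\<^sub>R \<pi> a \<in> Q" "\<beta> > 0" "z + \<beta> *\<^sub>R \<pi> b \<in> Q"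
      using tangent ab by blast
    then show "\<pi> a = 0"
      using l extreme_point_opposite_directions[OF z, of \<alpha> "\<pi> a" "\<beta> * ((1 - l) / l)"]
      by (simp add: eq)
    then show "\<pi> b = 0"
      by (simp add: eq)
  qed
  have e_\<pi>: "?e = P \<inter> {p. \<pi> p = 0}"
    by (auto simp: \<pi>_def algebra_simps)
  have "convex ?e"
    unfolding e_\<pi>
  proof (rule convex_Int[OF P(1)], rule convexI)
    fix x y :: "(real^2) \<times> real" and a b :: real
    assume h: "x \<in> {p. \<pi> p = 0}" "y \<in> {p. \<pi> p = 0}" "a + b = 1"
    then have b: "b = 1 - a"
      by simp
    have "\<pi> (a *\<^sub>R x + b *\<^sub>R y) = a *\<^sub>R \<pi> x + b *\<^sub>R \<pi> y"
      unfolding \<pi>_def b by (simp add: algebra_simps)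
    then show "a *\<^sub>R x + b *\<^sub>R y \<in> {p. \<pi> p = 0}"
      using h by simp
  qed
  then have "?e face_of P"
    using \<pi>0 unfolding face_of_def e_\<pi> by blast
  moreover have "aff_dim ?e = 1"
  proof -
    let ?s = "(z + \<sigma> *\<^sub>R u, \<sigma>)" and ?t = "(z + \<tau> *\<^sub>R u, \<tau>)"
    have ne: "?s \<noteq> ?t"
      using s t by auto
    have "?e \<subseteq> affine hull {?s, ?t}"
    proof
      fix p assume "p \<in> ?e"
      then have p: "p = (z + snd p *\<^sub>R u, snd p)"
        by (simp add: prod_eq_iff)
      let ?k = "(snd p - \<tau>) / (\<sigma> - \<tau>)"
      have k: "?k * \<sigma> + (1 - ?k) * \<tau> = snd p"
        using s t by (simp add: divide_simps) (simp add: algebra_simps)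
      have "?k *\<^sub>R ?s + (1 - ?k) *\<^sub>R ?t = (z + (?k * \<sigma> + (1 - ?k) * \<tau>) *\<^sub>R u, ?k * \<sigma> + (1 - ?k) * \<tau>)"
        by (simp add: scaleR_add_right scaleR_add_left scaleR_diff_left)
      then have "p = ?k *\<^sub>R ?s + (1 - ?k) *\<^sub>R ?t"
        using p unfolding k by simp
      then show "p \<in> affine hull {?s, ?t}"
        unfolding affine_hull_2 mem_Collect_eq by (metis add.commute diff_add_cancel)
    qed
    then have "aff_dim ?e \<le> aff_dim (affine hull {?s, ?t})"
      by (rule aff_dim_subset)
    then have "aff_dim ?e \<le> 1"
      using aff_dim_2[of ?s ?t] ne by (simp split: if_splits)
    moreover have "aff_dim {?s, ?t} \<le> aff_dim ?e"
      using s t by (intro aff_dim_subset) auto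
    ultimately show ?thesis
      using aff_dim_2[of ?s ?t] ne by (simp split: if_splits)
  qed
  ultimately show ?thesis
    by (simp add: edge_of_def)
qed

text \<open>The neighbor is a lattice point of \<open>e\<close> with least positive height
  \<open>\<kappa> * snd w\<close>; the sign \<open>\<kappa>\<close> treats both sides of the plane
  at once.\<close>

lemma lattice_neighbor_on_edge:
  fixes P :: "((real^2) \<times> real) set"
  assumes P: "lattice_polytope P" and e: "e edge_of P"
    and e_line: "\<And>p. p \<in> e \<Longrightarrow> fst p = z + snd p *\<^sub>R u"
    and z: "(z, 0) \<in> e" "z \<in> int_lattice"
    and \<kappa>: "\<kappa> \<in> {1, -1::real}" and p: "p \<in> e" "\<kappa> * snd p > 0"
  obtains w where "w \<in> e" "w \<in> int_lattice" "\<kappa> * snd w > 0" "lattice_neighbor P (z, 0) w"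
proof -
  have e_face: "e face_of P"
    using e by (simp add: edge_of_def)
  have "lattice_polytope e"
    using P e_face by (rule lattice_polytope_face_of)
  then have e_hull: "e = convex hull (e \<inter> int_lattice)"
    by (rule lattice_polytope_eq_hull)
  \<comment> \<open>Otherwise the hull of the lattice points of \<open>e\<close>, which is
    \<open>e\<close>, would stay in the closed half-space that excludes \<open>p\<close>.\<close>
  have "\<exists>w \<in> e \<inter> int_lattice. \<kappa> * snd w > 0"
  proof (rule ccontr)
    assume "\<not> ?thesis"
    then have "e \<inter> int_lattice \<subseteq> {w. (0, \<kappa>) \<bullet> w \<le> 0}"
      by force
    then have "convex hull (e \<inter> int_lattice) \<subseteq> {w. (0, \<kappa>) \<bullet> w \<le> 0}"
      by (rule hull_minimal) (rule convex_halfspace_le)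
    then have "(0, \<kappa>) \<bullet> p \<le> 0"
      using e_hull p by blast
    then show False
      using p by (cases p) simp
  qed
  then obtain w0 where w0: "w0 \<in> e \<and> w0 \<in> int_lattice \<and> \<kappa> * snd w0 > 0"
    by blast
  \<comment> \<open>Heights of lattice points are integers, so \<open>nat\<close> of the floor keeps
    the order among the positive ones and allows a minimum to be taken.\<close>
  obtain w where w: "w \<in> e" "w \<in> int_lattice" "\<kappa> * snd w > 0"
    and w_min: "\<And>y. y \<in> e \<Longrightarrow> y \<in> int_lattice \<Longrightarrow> \<kappa> * snd y > 0 \<Longrightarrow>
      nat \<lfloor>\<kappa> * snd w\<rfloor> \<le> nat \<lfloor>\<kappa> * snd y\<rfloor>"
    using ex_has_least_nat[of "\<lambda>w. w \<in> e \<and> w \<in> int_lattice \<and> \<kappa> * snd w > 0" w0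
        "\<lambda>w. nat \<lfloor>\<kappa> * snd w\<rfloor>"] w0 by blast
  have int: "\<kappa> * snd y \<in> \<int>" if "y \<in> int_lattice" for y :: "(real^2) \<times> real"
    using that \<kappa> by (cases y) auto
  have "y = (z, 0) \<or> y = w" if y: "y \<in> closed_segment (z, 0) w" "y \<in> int_lattice" for y
  proof -
    have "y \<in> e"
      using y z w e_face by (meson closed_segment_subset face_of_imp_convex subsetD)
    obtain l where l: "0 \<le> l" "l \<le> 1" "y = (1 - l) *\<^sub>R (z, 0) + l *\<^sub>R w"
      using y by (auto simp: in_segment)
    then have sy: "snd y = l * snd w"
      by simp
    show ?thesis
    proof (cases "l = 0")
      case True
      then show ?thesis using l by simp
    next
      case False
      then have pos: "\<kappa> * snd y > 0"
        using l w by (simp add: sy mult.left_commute[of \<kappa> l])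
      then have "nat \<lfloor>\<kappa> * snd w\<rfloor> \<le> nat \<lfloor>\<kappa> * snd y\<rfloor>"
        using w_min \<open>y \<in> e\<close> y by blast
      moreover obtain i j where "\<kappa> * snd w = of_int i" "\<kappa> * snd y = of_int j"
        using int y w by (meson Ints_cases)
      ultimately have "\<kappa> * snd w \<le> \<kappa> * snd y"
        using pos by (auto simp: nat_le_iff)
      also have "\<dots> = l * (\<kappa> * snd w)"
        by (simp add: sy)
      finally have "1 * (\<kappa> * snd w) \<le> l * (\<kappa> * snd w)"
        by simp
      then have "l = 1"
        using w(3) l(2) unfolding mult_le_cancel_right_pos[OF w(3)] by simp
      then show ?thesis using l by (simp flip: zero_prod_def)
    qed
  qed
  moreover have "w \<noteq> (z, 0)"
    using w by auto
  ultimately have "lattice_neighbor P (z, 0) w"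
    using e z w unfolding lattice_neighbor_def by auto
  then show thesis
    using w that by blast
qed

section \<open>From non-vertices of \<open>P\<close> to sections at infinity\<close>

text \<open>Holds monomial by monomial. If \<open>m \<bullet> z = -1\<close>, the affine function
  \<open>m \<bullet> v + 1\<close> of \<open>v\<close>, nonnegative at \<open>s\<close> and
  \<open>t\<close>, vanishes strictly between them and so at both; \<open>s\<close> and
  \<open>t\<close> then have exponent 0. If \<open>m \<bullet> z > -1\<close>, the monomial contains
  a positive power of the coordinate set to 0.\<close>

lemma restriction_independent_of_anticanonical_eqn:
  assumes rays: "{z, s, t} \<subseteq> fan_rays \<Sigma>" and seg: "z \<in> open_segment s t"
  shows "restriction_independent_of (anticanonical_eqn \<Sigma> c) z s t"
proof -
  have "(\<Prod>v\<in>fan_rays \<Sigma>. x v ^ nat \<lfloor>m \<bullet> v + 1\<rfloor>) = (\<Prod>v\<in>fan_rays \<Sigma>. y v ^ nat \<lfloor>m \<bullet> v + 1\<rfloor>)"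
    if m: "m \<in> anticanonical_exponents \<Sigma>"
      and xy: "x z = 0" "y z = 0" "\<forall>v. v \<noteq> s \<and> v \<noteq> t \<longrightarrow> x v = y v"
    for m and x y :: "'a \<Rightarrow> complex"
  proof (cases "finite (fan_rays \<Sigma>)")
    case fin: True
    have ge: "m \<bullet> z \<ge> -1" "m \<bullet> s \<ge> -1" "m \<bullet> t \<ge> -1"
      using m rays by (auto simp: anticanonical_exponents_def)
    show ?thesis
    proof (cases "m \<bullet> z = -1")
      case True
      obtain l where l: "0 < l" "l < 1" "z = (1 - l) *\<^sub>R s + l *\<^sub>R t"
        using seg by (auto simp: in_segment)
      have "m \<bullet> z = (1 - l) * (m \<bullet> s) + l * (m \<bullet> t)"
        unfolding l by (simp add: inner_add_right)
      then have "(1 - l) * (m \<bullet> s + 1) + l * (m \<bullet> t + 1) = 0"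
        using True by (simp add: algebra_simps)
      then have "(1 - l) * (m \<bullet> s + 1) = 0 \<and> l * (m \<bullet> t + 1) = 0"
        using l ge by (subst (asm) add_nonneg_eq_0_iff) auto
      then have "m \<bullet> s = -1" "m \<bullet> t = -1"
        using l by auto
      then show ?thesis
        using xy by (intro prod.cong refl) (metis add.left_inverse floor_zero power_0 nat_0)
    next
      case False
      have "m \<bullet> z \<in> \<int>"
        using m rays by (intro inner_int_lattice) (auto simp: anticanonical_exponents_def fan_rays_def)
      then obtain i where "m \<bullet> z = of_int i"
        by (meson Ints_cases)
      then have "nat \<lfloor>m \<bullet> z + 1\<rfloor> > 0"
        using False ge by auto
      then have "x z ^ nat \<lfloor>m \<bullet> z + 1\<rfloor> = 0" "y z ^ nat \<lfloor>m \<bullet> z + 1\<rfloor> = 0"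
        using xy by auto
      then have "(\<Prod>v\<in>fan_rays \<Sigma>. x v ^ nat \<lfloor>m \<bullet> v + 1\<rfloor>) = 0"
        "(\<Prod>v\<in>fan_rays \<Sigma>. y v ^ nat \<lfloor>m \<bullet> v + 1\<rfloor>) = 0"
        using rays fin by (meson insert_subset prod_zero)+
      then show ?thesis by simp
    qed
  \<comment> \<open>For infinitely many rays both products are 1 by convention.\<close>
  qed simp
  then show ?thesis
    unfolding restriction_independent_of_def anticanonical_eqn_def
    by (intro allI impI sum.cong refl arg_cong[where f = "\<lambda>p. _ * p"]) blast
qed

lemma slice_vertex_not_extreme_imp_section_at_infinity:
  assumes P: "reflexive_polytope P" "P \<inter> in_plane UNIV = in_plane Q" and Q: "lattice_polytope Q"
    and \<Sigma>: "fibered_resolution P \<Sigma>"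
    and z: "z extreme_point_of Q" "\<not> (z, 0) extreme_point_of P"
  shows "section_at_infinity Q P \<Sigma> z"
proof -
  have lat: "lattice_polytope P" and conv: "convex P"
    using P(1) by (auto simp: reflexive_polytope_def lattice_polytope_imp_polytope polytope_imp_convex)
  have zP: "(z, 0) \<in> P"
    using P(2) z(1) by (auto simp: in_plane_def extreme_point_of_def)
  have z_lat: "z \<in> int_lattice"
    using Q z(1) by (rule extreme_point_of_lattice_polytope)
  obtain a b where ab: "a \<in> P" "b \<in> P" "(z, 0) \<in> open_segment a b"
    using z(2) zP by (auto simp: extreme_point_of_def)
  obtain l where l: "0 < l" "l < 1" "(z, 0) = (1 - l) *\<^sub>R a + l *\<^sub>R b"
    using ab by (auto simp: in_segment)
  have l_snd: "(1 - l) * snd a + l * snd b = 0" and l_fst: "z = (1 - l) *\<^sub>R fst a + l *\<^sub>R fst b"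
    using l(3) by (auto simp: prod_eq_iff)
  \<comment> \<open>With both endpoints in the plane, the segment would lie in
    \<open>in_plane Q\<close>, where \<open>(z, 0)\<close> is extreme.\<close>
  have "snd a \<noteq> 0"
  proof
    assume a0: "snd a = 0"
    then have "snd b = 0"
      using l l_snd by simp
    with a0 have "a \<in> in_plane Q" "b \<in> in_plane Q"
      using ab unfolding P(2)[symmetric] by (auto simp: in_plane_def mem_Times_iff)
    moreover have "(z, 0) extreme_point_of in_plane Q"
      using z(1) by simp
    ultimately show False
      using ab(3) by (auto simp: extreme_point_of_def)
  qed
  \<comment> \<open>The direction is scaled to height 1, so that heights parametrize the line
    through \<open>a\<close> and \<open>(z, 0)\<close>; \<open>b\<close> is then shown to lie on
    it.\<close>
  define u where "u = (1 / snd a) *\<^sub>R (fst a - z)"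
  have a: "a = (z + snd a *\<^sub>R u, snd a)"
    using \<open>snd a \<noteq> 0\<close> by (simp add: u_def prod_eq_iff)
  have sb: "snd b = - ((1 - l) / l) * snd a"
    using l l_snd by (simp add: field_simps)
  have "l *\<^sub>R (z + snd b *\<^sub>R u) = l *\<^sub>R fst b"
  proof -
    have "l *\<^sub>R fst b = z - (1 - l) *\<^sub>R fst a"
      using l_fst by (metis add_diff_cancel_left')
    also have "\<dots> = z - (1 - l) *\<^sub>R (z + snd a *\<^sub>R u)"
      using a by (metis fst_conv)
    also have "\<dots> = l *\<^sub>R z - ((1 - l) * snd a) *\<^sub>R u"
      by (simp add: algebra_simps)
    also have "(1 - l) * snd a = - (l * snd b)"
      using l_snd by simp
    finally show ?thesis
      by (simp add: scaleR_add_right)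
  qed
  then have b: "b = (z + snd b *\<^sub>R u, snd b)"
    using l by (simp add: prod_eq_iff)
  define e where "e = {p \<in> P. fst p = z + snd p *\<^sub>R u}"
  have e_mem: "a \<in> e" "b \<in> e" "(z, 0) \<in> e"
    using a b ab zP by (auto simp: e_def prod_eq_iff)
  obtain p q where pq: "p \<in> e" "snd p > 0" "q \<in> e" "snd q < 0"
  proof (cases "snd a > 0")
    case True
    then have "snd b < 0"
      using l unfolding sb by (simp add: field_simps)
    then show thesis using that True e_mem by blast
  next
    case False
    then have "snd b > 0"
      using l \<open>snd a \<noteq> 0\<close> unfolding sb by (simp add: field_simps mult_pos_neg)
    then show thesis using that False \<open>snd a \<noteq> 0\<close> e_mem by (meson linorder_neqE_linordered_idom)
  qed
  have "(z + snd p *\<^sub>R u, snd p) = p" "(z + snd q *\<^sub>R u, snd q) = q"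
    using pq by (auto simp: e_def prod_eq_iff)
  then have edge: "e edge_of P"
    unfolding e_def using pq
    by (intro edge_of_through_slice_vertex[OF conv P(2) z(1), of "snd p" u "snd q"]) (auto simp: e_def)
  have line: "\<And>p. p \<in> e \<Longrightarrow> fst p = z + snd p *\<^sub>R u"
    by (simp add: e_def)
  obtain s where s: "s \<in> e" "s \<in> int_lattice" "snd s > 0" "lattice_neighbor P (z, 0) s"
    using lattice_neighbor_on_edge[OF lat edge line e_mem(3) z_lat, of 1 p] pq by auto
  obtain t where t: "t \<in> e" "t \<in> int_lattice" "snd t < 0" "lattice_neighbor P (z, 0) t"
    using lattice_neighbor_on_edge[OF lat edge line e_mem(3) z_lat, of "-1" q] pq by auto
  \<comment> \<open>The resolution turns every lattice point of the edge into a ray, so both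
    neighbors have Cox coordinates.\<close>
  have "e \<inter> int_lattice \<subseteq> fan_rays \<Sigma>"
    using \<Sigma> edge by (simp add: fibered_resolution_def)
  moreover have "(z, 0::real) \<in> int_lattice"
    using z_lat by simp
  ultimately have rays: "{(z, 0), s, t} \<subseteq> fan_rays \<Sigma>"
    using s(1,2) t(1,2) e_mem(3) by blast
  have "(z, 0) \<in> open_segment s t"
  proof -
    let ?k = "snd s / (snd s - snd t)"
    have k: "(1 - ?k) * snd s + ?k * snd t = 0"
      using s t by (simp add: divide_simps)
    have "(1 - ?k) *\<^sub>R s + ?k *\<^sub>R t
      = (z + ((1 - ?k) * snd s + ?k * snd t) *\<^sub>R u, (1 - ?k) * snd s + ?k * snd t)"
      unfolding prod_eq_iff by (simp add: line s t algebra_simps)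
    then have "(z, 0) = (1 - ?k) *\<^sub>R s + ?k *\<^sub>R t"
      unfolding k by simp
    moreover have "0 < ?k" "?k < 1" "s \<noteq> t"
      using s t by (auto simp: divide_simps)
    ultimately show ?thesis
      unfolding in_segment by blast
  qed
  then have "restriction_independent_of (anticanonical_eqn \<Sigma> c) (z, 0) s t" for c
    using rays by (rule restriction_independent_of_anticanonical_eqn[rotated])
  \<comment> \<open>Independence holds for every choice of coefficients, so the constant polynomial
    1 serves to define the open set.\<close>
  moreover have "(\<lambda>_. 1) \<in> poly_functions (anticanonical_exponents \<Sigma>)"
    by (rule poly_functions.const)
  ultimately have "for_general (anticanonical_exponents \<Sigma>)
      (\<lambda>c. restriction_independent_of (anticanonical_eqn \<Sigma> c) (z, 0) s t)"
    unfolding for_general_def by (intro bexI[of _ "\<lambda>_. 1"]) auto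
  then show ?thesis
    using P z(1) \<Sigma> rays s t unfolding section_at_infinity_def fibered_resolution_def by blast
qed

section \<open>From sections at infinity to non-vertices of \<open>P\<close>\<close>

text \<open>By reflexivity \<open>P\<close> is cut out by finitely many inequalities with lattice
  normals \<open>V\<close>. If all those tight at \<open>x\<close> were tight at \<open>s\<close>, a
  small step from \<open>x\<close> away from \<open>s\<close> would keep tight ones tight and slack
  ones slack, and \<open>x\<close> would lie strictly between two points of
  \<open>P\<close>.\<close>

lemma lattice_functional_separating_vertex:
  assumes P: "reflexive_polytope P" and x: "x extreme_point_of P" and s: "s \<in> P" "s \<noteq> x"
  obtains m where "m \<in> int_lattice" "m \<in> dual_polytope P" "m \<bullet> x = -1" "m \<bullet> s > -1"
proof (rule ccontr)
  assume "\<not> thesis"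
  with that have none: "\<not> m \<bullet> s > -1"
    if "m \<in> int_lattice" "m \<in> dual_polytope P" "m \<bullet> x = -1" for m
    using that by blast
  obtain V where V: "finite V" "V \<subseteq> int_lattice" "dual_polytope P = convex hull V"
    using P by (auto simp: reflexive_polytope_def lattice_polytope_def)
  have VP: "V \<subseteq> dual_polytope P"
    by (simp add: V hull_subset)
  have xP: "x \<in> P"
    using x by (simp add: extreme_point_of_def)
  have "\<forall>m\<in>V. \<forall>\<^sub>F \<epsilon> in at_right 0. m \<bullet> (x + \<epsilon> *\<^sub>R (x - s)) \<ge> -1"
  proof
    fix m assume m: "m \<in> V"
    then have ge: "m \<bullet> x \<ge> -1" "m \<bullet> s \<ge> -1"
      using VP xP s by (auto simp: dual_polytope_def)
    show "\<forall>\<^sub>F \<epsilon> in at_right 0. m \<bullet> (x + \<epsilon> *\<^sub>R (x - s)) \<ge> -1"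
    proof (cases "m \<bullet> x = -1")
      case True
      then have "m \<bullet> s = -1"
        using none[of m] m V VP ge by force
      then show ?thesis
        using True by (simp add: inner_add_right inner_diff_right)
    next
      case False
      have "((\<lambda>\<epsilon>. m \<bullet> (x + \<epsilon> *\<^sub>R (x - s))) \<longlongrightarrow> m \<bullet> (x + 0 *\<^sub>R (x - s))) (at_right 0)"
        by (intro tendsto_intros)
      then have "\<forall>\<^sub>F \<epsilon> in at_right 0. m \<bullet> (x + \<epsilon> *\<^sub>R (x - s)) > -1"
        using False ge by (intro order_tendstoD(1)) auto
      then show ?thesis
        by eventually_elim simp
    qed
  qed
  \<comment> \<open>Finiteness of \<open>V\<close> gives one step length for all
    inequalities.\<close>
  then have "\<forall>\<^sub>F \<epsilon> in at_right 0. \<forall>m\<in>V. m \<bullet> (x + \<epsilon> *\<^sub>R (x - s)) \<ge> -1"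
    using V(1) by (simp add: eventually_ball_finite)
  then have "\<forall>\<^sub>F \<epsilon> in at_right (0::real). \<epsilon> > 0 \<and> (\<forall>m\<in>V. m \<bullet> (x + \<epsilon> *\<^sub>R (x - s)) \<ge> -1)"
    using eventually_at_right_less[of "0::real"] by eventually_elim simp
  then obtain \<epsilon> :: real where \<epsilon>: "\<epsilon> > 0" "\<And>m. m \<in> V \<Longrightarrow> m \<bullet> (x + \<epsilon> *\<^sub>R (x - s)) \<ge> -1"
    using eventually_happens trivial_limit_at_right_real by blast
  let ?y = "x + \<epsilon> *\<^sub>R (x - s)"
  have "convex hull V \<subseteq> {m. ?y \<bullet> m \<ge> -1}"
    using \<epsilon>(2) by (intro hull_minimal convex_halfspace_ge) (auto simp: inner_commute)
  then have "?y \<in> dual_polytope (dual_polytope P)"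
    unfolding V(3) by (auto simp: dual_polytope_def)
  then have "?y \<in> P"
    using reflexive_polytope_dual_dual[OF P] by simp
  then have "x - s = 0"
    using extreme_point_opposite_directions[OF x, of \<epsilon> "x - s" 1] \<epsilon>(1) s by simp
  then show False
    using s by simp
qed

lemma continuous_poly_function_coord:
  assumes "q \<in> poly_functions I"
  shows "continuous_on UNIV (\<lambda>h. q (c(i := c i + h)))"
  using assms
proof induction
  case (coord j)
  then show ?case
    by (cases "j = i") (auto intro!: continuous_intros)
qed (auto intro!: continuous_intros)

text \<open>Continuity in one coefficient keeps the defining polynomial nonzero nearby, so two
  general points can differ in that coefficient alone.\<close>

lemma for_general_perturb:
  assumes "for_general I \<Phi>"
  obtains c h where "h \<noteq> 0" "\<Phi> c" "\<Phi> (c(i := c i + h))"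
proof -
  obtain q c where q: "q \<in> poly_functions I" "q c \<noteq> 0" "\<And>c. q c \<noteq> 0 \<Longrightarrow> \<Phi> c"
    using assms by (auto simp: for_general_def)
  have "isCont (\<lambda>h. q (c(i := c i + h))) 0"
    using continuous_poly_function_coord[OF q(1)] by (simp add: continuous_on_eq_continuous_at)
  then have "((\<lambda>h. q (c(i := c i + h))) \<longlongrightarrow> q c) (at 0)"
    by (simp add: isCont_def)
  then have "\<forall>\<^sub>F h in at 0. q (c(i := c i + h)) \<noteq> 0"
    using q(2) by (rule tendsto_imp_eventually_ne)
  then have "\<forall>\<^sub>F h in at 0. h \<noteq> 0 \<and> q (c(i := c i + h)) \<noteq> 0"
    using eventually_neq_at_within[of 0 0 UNIV] by eventually_elim simp
  then obtain h where "h \<noteq> 0" "q (c(i := c i + h)) \<noteq> 0"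
    using eventually_happens'[OF at_neq_bot] by blast
  then show thesis
    using that q by blast
qed

lemma anticanonical_eqn_update:
  assumes "finite (anticanonical_exponents \<Sigma>)" "m \<in> anticanonical_exponents \<Sigma>"
  shows "anticanonical_eqn \<Sigma> (c(m := c m + h)) x
    = anticanonical_eqn \<Sigma> c x + h * (\<Prod>v\<in>fan_rays \<Sigma>. x v ^ nat \<lfloor>m \<bullet> v + 1\<rfloor>)"
  unfolding anticanonical_eqn_def sum.remove[OF assms] by (simp add: algebra_simps)

lemma fan_rays_subset_int_lattice: "fan_rays \<Sigma> \<subseteq> int_lattice"
  by (auto simp: fan_rays_def)

text \<open>Rays lie in \<open>P\<close>, which gives one inclusion. For the other, each vertex of
  \<open>P\<close> lies on an edge and so is a ray, and \<open>P\<close> is the hull of its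
  vertices.\<close>

lemma anticanonical_exponents_fibered_resolution:
  assumes P: "reflexive_polytope P" and \<Sigma>: "fibered_resolution P \<Sigma>"
  shows "anticanonical_exponents \<Sigma> = dual_polytope P \<inter> int_lattice"
proof
  have "fan_rays \<Sigma> \<subseteq> P"
    using \<Sigma> by (simp add: fibered_resolution_def fibered_refinement_def)
  then show "dual_polytope P \<inter> int_lattice \<subseteq> anticanonical_exponents \<Sigma>"
    by (auto simp: anticanonical_exponents_def dual_polytope_def)
  have lat: "lattice_polytope P" and poly: "polytope P"
    using P by (auto simp: reflexive_polytope_def lattice_polytope_imp_polytope)
  have "interior P \<noteq> {}"
    using P by (auto simp: reflexive_polytope_def)
  then have "aff_dim P = 3"
    by (simp add: aff_dim_nonempty_interior)
  then have "v \<in> fan_rays \<Sigma>" if "v extreme_point_of P" for v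
    using \<Sigma> extreme_point_on_edge[OF poly that] extreme_point_of_lattice_polytope[OF lat that]
    unfolding fibered_resolution_def by (metis IntI subsetD)
  moreover have P_hull: "P = convex hull {v. v extreme_point_of P}"
    using poly by (simp add: Krein_Milman_Minkowski polytope_imp_compact polytope_imp_convex)
  ultimately have "P \<subseteq> {v. m \<bullet> v \<ge> -1}" if "m \<in> anticanonical_exponents \<Sigma>" for m
    using that by (subst P_hull, intro hull_minimal)
      (auto simp: anticanonical_exponents_def convex_halfspace_ge)
  then show "anticanonical_exponents \<Sigma> \<subseteq> dual_polytope P \<inter> int_lattice"
    by (auto simp: anticanonical_exponents_def dual_polytope_def)
qed

text \<open>
  At a vertex \<open>(z, 0)\<close> of \<open>P\<close> some anticanonical monomial involves \<open>s\<close> but not \<open>z\<close>; comparing two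
  general equations that differ only in its coefficient isolates this monomial.
\<close>

lemma section_at_infinity_imp_not_extreme:
  assumes \<Sigma>: "fibered_resolution P \<Sigma>" and sec: "section_at_infinity Q P \<Sigma> z"
  shows "\<not> (z, 0) extreme_point_of P"
proof
  assume ext: "(z, 0) extreme_point_of P"
  have P: "reflexive_polytope P"
    using sec by (simp add: section_at_infinity_def)
  obtain s t where st: "{(z, 0), s, t} \<subseteq> fan_rays \<Sigma>" "snd s > 0"
    and gen: "for_general (anticanonical_exponents \<Sigma>)
          (\<lambda>c. restriction_independent_of (anticanonical_eqn \<Sigma> c) (z, 0) s t)"
    using sec unfolding section_at_infinity_def by blast
  have raysP: "fan_rays \<Sigma> \<subseteq> P"
    using \<Sigma> by (simp add: fibered_resolution_def fibered_refinement_def)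
  have bounded: "bounded P" "bounded (dual_polytope P)"
    using P by (auto simp: reflexive_polytope_def lattice_polytope_imp_polytope polytope_imp_bounded)
  have fin: "finite (fan_rays \<Sigma>)" "finite (anticanonical_exponents \<Sigma>)"
    using finite_subset[OF Int_greatest[OF raysP fan_rays_subset_int_lattice]]
      finite_bounded_Int_int_lattice[OF bounded(1)] finite_bounded_Int_int_lattice[OF bounded(2)]
      anticanonical_exponents_fibered_resolution[OF P \<Sigma>]
    by auto
  have s_ne: "s \<noteq> (z, 0)"
    using st by auto
  then obtain m where m: "m \<in> int_lattice" "m \<in> dual_polytope P" "m \<bullet> (z, 0) = -1" "m \<bullet> s > -1"
    using lattice_functional_separating_vertex[OF P ext, of s] st raysP by auto
  then have mI: "m \<in> anticanonical_exponents \<Sigma>"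
    using anticanonical_exponents_fibered_resolution[OF P \<Sigma>] by simp
  obtain c h where h: "h \<noteq> 0"
    and ind: "restriction_independent_of (anticanonical_eqn \<Sigma> c) (z, 0) s t"
      "restriction_independent_of (anticanonical_eqn \<Sigma> (c(m := c m + h))) (z, 0) s t"
    using for_general_perturb[OF gen] by blast
  let ?mon = "\<lambda>x. \<Prod>v\<in>fan_rays \<Sigma>. x v ^ nat \<lfloor>m \<bullet> v + 1\<rfloor>"
  \<comment> \<open>Both points have coordinate 0 at \<open>(z, 0)\<close> and only \<open>y\<close>
    has coordinate 0 at \<open>s\<close>, so the monomial of \<open>m\<close> takes the values 1 at
    \<open>x\<close> and 0 at \<open>y\<close>.\<close>
  define x :: "(real^2) \<times> real \<Rightarrow> complex" where "x v = (if v = (z, 0) then 0 else 1)" for v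
  define y where "y = x(s := 0)"
  have xy: "x (z, 0) = 0 \<and> y (z, 0) = 0 \<and> (\<forall>v. v \<noteq> s \<and> v \<noteq> t \<longrightarrow> x v = y v)"
    by (simp add: x_def y_def)
  have "anticanonical_eqn \<Sigma> c x = anticanonical_eqn \<Sigma> c y"
    "anticanonical_eqn \<Sigma> (c(m := c m + h)) x = anticanonical_eqn \<Sigma> (c(m := c m + h)) y"
    using ind xy unfolding restriction_independent_of_def by blast+
  then have "?mon x = ?mon y"
    using h by (simp add: anticanonical_eqn_update[OF fin(2) mI])
  \<comment> \<open>The exponent of \<open>(z, 0)\<close> is 0, so its factor is
    \<open>0 ^ 0 = 1\<close>.\<close>
  moreover have "nat \<lfloor>m \<bullet> (z, 0) + 1\<rfloor> = 0"
    unfolding m(3) by (metis add.left_inverse floor_zero nat_0)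
  then have "?mon x = 1"
    by (intro prod.neutral ballI) (auto simp only: x_def power_0 power_one split: if_splits)
  moreover have "?mon y = 0"
  proof (rule prod_zero[OF fin(1)], rule bexI)
    show "s \<in> fan_rays \<Sigma>"
      using st by simp
    obtain i where "m \<bullet> s = of_int i"
      using inner_int_lattice[OF m(1), of s] st fan_rays_subset_int_lattice[of \<Sigma>]
      by (meson Ints_cases insert_subset subsetD)
    then show "y s ^ nat \<lfloor>m \<bullet> s + 1\<rfloor> = 0"
      using m(4) by (simp add: y_def)
  qed
  ultimately show False
    by simp
qed

section \<open>Candelas' conditions and automorphisms of the lattice\<close>

text \<open>The fan-free form of a section at infinity, which can be carried through automorphisms
  of \<open>N\<close>.\<close>

definition fiber_with_hidden_vertex :: "(real^2) set \<Rightarrow> ((real^2) \<times> real) set \<Rightarrow> bool" where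
  "fiber_with_hidden_vertex Q P \<longleftrightarrow> P \<inter> in_plane UNIV = in_plane Q \<and>
     (\<exists>z. z extreme_point_of Q \<and> \<not> (z, 0) extreme_point_of P)"

text \<open>Both sides include the condition that the slice is \<open>in_plane Q\<close>, so the
  resolution is available as soon as either side is assumed.\<close>

lemma has_section_at_infinity_iff:
  assumes "reflexive_polytope P" "lattice_polytope Q"
    and "P \<inter> in_plane UNIV = in_plane Q \<longrightarrow> fibered_resolution P \<Sigma>"
  shows "has_section_at_infinity Q P \<Sigma> \<longleftrightarrow> fiber_with_hidden_vertex Q P"
proof
  assume "has_section_at_infinity Q P \<Sigma>"
  then obtain z where z: "section_at_infinity Q P \<Sigma> z"
    by (auto simp: has_section_at_infinity_def)
  then have "P \<inter> in_plane UNIV = in_plane Q" "z extreme_point_of Q"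
    by (simp_all add: section_at_infinity_def)
  then show "fiber_with_hidden_vertex Q P"
    using section_at_infinity_imp_not_extreme z assms(3) unfolding fiber_with_hidden_vertex_def by blast
next
  assume "fiber_with_hidden_vertex Q P"
  then show "has_section_at_infinity Q P \<Sigma>"
    using slice_vertex_not_extreme_imp_section_at_infinity assms
    unfolding fiber_with_hidden_vertex_def has_section_at_infinity_def by blast
qed

text \<open>Projection commutes with convex hulls, and both polytopes are hulls of their lattice
  points. Conversely, a lattice point \<open>x\<close> of \<open>Q\<close> lifts to
  \<open>(x, 0)\<close>.\<close>

lemma candelas_conditions_iff:
  assumes P: "lattice_polytope P" and Q: "lattice_polytope Q" and QP: "in_plane Q \<subseteq> P"
  shows "candelas_conditions Q P \<longleftrightarrow> fst ` P = Q \<and> fiber_with_hidden_vertex Q P"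
proof
  assume cand: "candelas_conditions Q P"
  have "fst ` P = fst ` (convex hull (P \<inter> int_lattice))"
    using lattice_polytope_eq_hull[OF P] by simp
  also have "\<dots> = convex hull (Q \<inter> int_lattice)"
    using cand by (simp add: convex_hull_linear_image linear_fst candelas_conditions_def)
  also have "\<dots> = Q"
    using lattice_polytope_eq_hull[OF Q] by simp
  finally have fst: "fst ` P = Q" .
  then have "P \<inter> in_plane UNIV = in_plane Q"
    using QP by (force simp: in_plane_def)
  then show "fst ` P = Q \<and> fiber_with_hidden_vertex Q P"
    using fst cand by (simp add: candelas_conditions_def fiber_with_hidden_vertex_def)
next
  assume R: "fst ` P = Q \<and> fiber_with_hidden_vertex Q P"
  have "fst ` (P \<inter> int_lattice) \<subseteq> Q \<inter> int_lattice"
    using R by force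
  moreover have "Q \<inter> int_lattice \<subseteq> fst ` (P \<inter> int_lattice)"
  proof
    fix x assume "x \<in> Q \<inter> int_lattice"
    then have "(x, 0) \<in> P \<inter> int_lattice"
      using QP by (auto simp: in_plane_def)
    then show "x \<in> fst ` (P \<inter> int_lattice)"
      by force
  qed
  ultimately show "candelas_conditions Q P"
    using R by (auto simp: candelas_conditions_def fiber_with_hidden_vertex_def)
qed

lemma lattice_equivalent_sym:
  assumes "lattice_equivalent Q P Q' P'"
  shows "lattice_equivalent Q' P' Q P"
proof -
  obtain g where g: "linear g" "bij g" "g ` int_lattice = int_lattice"
    "g ` in_plane int_lattice = in_plane int_lattice"
    "g ` in_plane Q = in_plane Q'" "g ` P = P'"
    using assms by (auto simp: lattice_equivalent_def)
  have "linear (inv g)"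
    using g by (simp add: inj_linear_imp_inv_linear bij_is_inj)
  moreover have "inv g ` B = A" if "g ` A = B" for A B
    using that g(2) by (metis bij_is_inj image_inv_f_f)
  ultimately show ?thesis
    unfolding lattice_equivalent_def using g(3-) bij_imp_bij_inv[OF g(2)]
    by (intro exI[of _ "inv g"] conjI)
qed

text \<open>The third coordinate of \<open>g (x, 0)\<close> is linear in \<open>x\<close> and
  vanishes on the standard basis, which consists of lattice points.\<close>

lemma in_plane_UNIV_invariant:
  assumes g: "linear g" and lat: "g ` in_plane int_lattice \<subseteq> in_plane int_lattice"
  shows "g ` in_plane UNIV \<subseteq> in_plane UNIV"
proof -
  have "linear (\<lambda>x::real^2. (x, 0::real))"
    by (auto intro!: linearI)
  then have "linear (\<lambda>x. snd (g (x, 0)))"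
    using linear_compose[OF _ linear_compose[OF g linear_snd]] by (simp add: o_def)
  moreover have "snd (g (b, 0)) = 0" if "b \<in> Basis" for b
  proof -
    have "b \<in> int_lattice"
      using that by (auto simp: int_lattice_def inner_Basis)
    then have "g (b, 0) \<in> in_plane int_lattice"
      using lat by (auto simp: in_plane_def)
    then show ?thesis
      by (auto simp: in_plane_def)
  qed
  ultimately have "(\<lambda>x. snd (g (x, 0))) = (\<lambda>x. 0)"
    by (intro linear_eq_stdbasis) (auto simp: linear_zero)
  then show ?thesis
    by (auto simp: in_plane_def) (metis snd_conv)
qed

text \<open>A linear bijection preserving the plane carries slices to slices and extreme points to
  extreme points.\<close>

lemma lattice_equivalent_fiber_with_hidden_vertex:
  assumes eqv: "lattice_equivalent Q P Q' P'" and hid: "fiber_with_hidden_vertex Q P"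
  shows "fiber_with_hidden_vertex Q' P'"
proof -
  obtain g where g: "linear g" "bij g" "g ` in_plane int_lattice = in_plane int_lattice"
    "g ` in_plane Q = in_plane Q'" "g ` P = P'"
    using eqv by (auto simp: lattice_equivalent_def)
  have inj: "inj g"
    using g by (simp add: bij_is_inj)
  \<comment> \<open>The inverse maps the plane into itself as well, which turns the inclusion into
    an equality.\<close>
  have "inv g ` in_plane int_lattice = in_plane int_lattice"
    using inj g(3) by (metis image_inv_f_f)
  then have "inv g ` in_plane UNIV \<subseteq> in_plane UNIV"
    using g inj by (intro in_plane_UNIV_invariant) (auto simp: inj_linear_imp_inv_linear)
  then have "g ` inv g ` in_plane UNIV \<subseteq> g ` in_plane UNIV"
    by (rule image_mono)
  then have plane: "g ` in_plane UNIV = in_plane UNIV"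
    using in_plane_UNIV_invariant[OF g(1)] g(2,3) by (simp add: image_f_inv_f bij_is_surj)
  have "P' \<inter> in_plane UNIV = g ` (P \<inter> in_plane UNIV)"
    unfolding image_Int[OF inj] plane g(5) ..
  also have "\<dots> = in_plane Q'"
    using hid g(4) by (simp add: fiber_with_hidden_vertex_def)
  finally have slice: "P' \<inter> in_plane UNIV = in_plane Q'" .
  obtain z where z: "z extreme_point_of Q" "\<not> (z, 0) extreme_point_of P"
    using hid by (auto simp: fiber_with_hidden_vertex_def)
  have "(z, 0) \<in> in_plane UNIV"
    by (simp add: in_plane_def)
  then have "g (z, 0) \<in> in_plane UNIV"
    using plane by blast
  then obtain z' where z': "g (z, 0) = (z', 0)"
    by (auto simp: in_plane_def)
  have "z' extreme_point_of Q'"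
    using z(1) extreme_point_of_linear_image_iff[OF g(1) inj, of "(z, 0)" "in_plane Q"]
    unfolding g(4) z' by simp
  moreover have "\<not> (z', 0) extreme_point_of P'"
    using z(2) extreme_point_of_linear_image_iff[OF g(1) inj, of "(z, 0)" P]
    unfolding g(5) z' by simp
  ultimately show ?thesis
    using slice by (auto simp: fiber_with_hidden_vertex_def)
qed

text \<open>Transports the hypotheses of \<open>candelas_conditions_iff\<close> to the new
  coordinates. \<open>Q'\<close> is reached by embedding \<open>Q\<close> in the plane, applying
  \<open>g\<close> and projecting back.\<close>

lemma lattice_equivalent_lattice_polytopes:
  assumes eqv: "lattice_equivalent Q P Q' P'"
    and P: "lattice_polytope P" and Q: "lattice_polytope Q" and QP: "in_plane Q \<subseteq> P"
  shows "lattice_polytope P'" "lattice_polytope Q'" "in_plane Q' \<subseteq> P'"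
proof -
  obtain g where g: "linear g" "g ` int_lattice = int_lattice"
    "g ` in_plane Q = in_plane Q'" "g ` P = P'"
    using eqv by (auto simp: lattice_equivalent_def)
  show "lattice_polytope P'"
    using lattice_polytope_linear_image[OF P g(1)] g by simp
  show "in_plane Q' \<subseteq> P'"
    using QP g by blast
  have "linear (\<lambda>x::real^2. (x, 0::real))"
    by (auto intro!: linearI)
  then have "lattice_polytope ((\<lambda>x. (x, 0::real)) ` Q)"
    by (rule lattice_polytope_linear_image[OF Q]) auto
  moreover have "(\<lambda>x. (x, 0::real)) ` Q = in_plane Q"
    by (auto simp: in_plane_def)
  ultimately have "lattice_polytope (in_plane Q)"
    by simp
  then have "lattice_polytope (g ` in_plane Q)"
    by (rule lattice_polytope_linear_image[OF _ g(1)]) (simp add: g(2))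
  then have "lattice_polytope (fst ` in_plane Q')"
    unfolding g(3) by (rule lattice_polytope_linear_image[OF _ linear_fst]) auto
  then show "lattice_polytope Q'"
    by (simp add: in_plane_def)
qed

section \<open>Duals of reflexive subpolytopes of the semistable dual\<close>

text \<open>Duality reverses both inclusions: \<open>\<Delta> \<subseteq> dual_polytope S\<close>
  puts \<open>S\<close> into the dual of \<open>\<Delta>\<close>, and the copy of
  \<open>dual_polytope Q\<close> inside \<open>\<Delta>\<close> cuts the slice of that dual down to
  \<open>Q\<close>.\<close>

lemma dual_polytope_semistable:
  assumes Q: "reflexive_polytope Q" and ss: "semistable_polytope Q z s t S"
    and \<Delta>: "reflexive_polytope \<Delta>" "\<Delta> \<subseteq> dual_polytope S" "in_plane (dual_polytope Q) \<subseteq> \<Delta>"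
  shows "S \<subseteq> dual_polytope \<Delta>" "dual_polytope \<Delta> \<inter> in_plane UNIV = in_plane Q"
    "z extreme_point_of Q" "\<not> (z, 0) extreme_point_of dual_polytope \<Delta>"
proof -
  show sub: "S \<subseteq> dual_polytope \<Delta>"
  proof
    fix x assume "x \<in> S"
    then have "x \<bullet> m \<ge> -1" if "m \<in> \<Delta>" for m
      using that \<Delta>(2) by (metis (mono_tags, lifting) dual_polytope_def inner_commute mem_Collect_eq subsetD)
    then show "x \<in> dual_polytope \<Delta>"
      by (simp add: dual_polytope_def)
  qed
  have S: "S = convex hull (in_plane Q \<union> closed_segment s t)" and mid: "(z, 0) = midpoint s t"
    and span: "span ({s, t} \<union> in_plane {v. v extreme_point_of Q}) = UNIV"
    and z: "z extreme_point_of Q"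
    using ss by (auto simp: semistable_polytope_def)
  show "z extreme_point_of Q"
    by (fact z)
  have hull: "in_plane Q \<union> closed_segment s t \<subseteq> dual_polytope \<Delta>"
    by (rule subset_trans[OF hull_subset sub[unfolded S]])
  have "x \<in> Q" if "(x, 0) \<in> dual_polytope \<Delta>" for x
  proof -
    have "x \<bullet> m \<ge> -1" if "m \<in> dual_polytope Q" for m
    proof -
      have "(m, 0) \<in> \<Delta>"
        using that \<Delta>(3) by (auto simp: in_plane_def)
      then show ?thesis
        using \<open>(x, 0) \<in> dual_polytope \<Delta>\<close> unfolding dual_polytope_def mem_Collect_eq
        by (metis add.right_neutral inner_Pair mult_zero_left inner_real_def)
    qed
    then have "x \<in> dual_polytope (dual_polytope Q)"
      by (simp add: dual_polytope_def[of "dual_polytope Q"])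
    then show ?thesis
      by (simp add: reflexive_polytope_dual_dual[OF Q])
  qed
  then show "dual_polytope \<Delta> \<inter> in_plane UNIV = in_plane Q"
    using hull by (auto simp: in_plane_def)
  \<comment> \<open>For \<open>s = t\<close> both endpoints would be \<open>(z, 0)\<close>, and the
    spanning set would lie in the plane.\<close>
  have "s \<noteq> t"
  proof
    assume "s = t"
    then have "s = (z, 0)" "t = (z, 0)"
      using mid by auto
    then have "{s, t} \<union> in_plane {v. v extreme_point_of Q} \<subseteq> {p. snd p = 0}"
      by (auto simp: in_plane_def)
    moreover have "subspace {p :: (real^2) \<times> real. snd p = 0}"
      by (auto simp: subspace_def)
    ultimately have "UNIV \<subseteq> {p :: (real^2) \<times> real. snd p = 0}"
      using span_minimal span by metis
    then have "(0, 1) \<in> {p :: (real^2) \<times> real. snd p = 0}"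
      by blast
    then show False
      by simp
  qed
  then have "(z, 0) \<in> open_segment s t"
    unfolding mid by simp
  moreover have "s \<in> dual_polytope \<Delta>" "t \<in> dual_polytope \<Delta>"
    using hull by auto
  ultimately show "\<not> (z, 0) extreme_point_of dual_polytope \<Delta>"
    by (auto simp: extreme_point_of_def)
qed

theorem theorem4p13:
  fixes nabla_phi :: "(real^2) set"
  assumes "reflexive_polytope nabla_phi"
  shows
    "(\<forall>nabla_s v_z v_s v_t \<Delta>.
        semistable_polytope nabla_phi v_z v_s v_t nabla_s \<and>
        reflexive_polytope \<Delta> \<and>
        \<Delta> \<subseteq> dual_polytope nabla_s \<and>
        in_plane (dual_polytope nabla_phi) \<subseteq> \<Delta> \<longrightarrow>
          (nabla_s \<subseteq> dual_polytope \<Delta> \<and>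
           reflexive_polytope (dual_polytope \<Delta>) \<and>
           dual_polytope \<Delta> \<inter> in_plane UNIV = in_plane nabla_phi) \<and>
          (\<forall>\<Sigma>. fibered_resolution (dual_polytope \<Delta>) \<Sigma> \<longrightarrow>
             section_at_infinity nabla_phi (dual_polytope \<Delta>) \<Sigma> v_z))
     \<and>
     (\<forall>nabla \<Sigma>.
        reflexive_polytope nabla \<and>
        in_plane nabla_phi \<subseteq> nabla \<and>
        (nabla \<inter> in_plane UNIV = in_plane nabla_phi \<longrightarrow> fibered_resolution nabla \<Sigma>) \<longrightarrow>
          (candelas_conditions nabla_phi nabla \<longleftrightarrow>
             fst ` nabla = nabla_phi \<and> has_section_at_infinity nabla_phi nabla \<Sigma>) \<and>
          (candelas_up_to_automorphism nabla_phi nabla \<longleftrightarrow>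
             projects_up_to_automorphism nabla_phi nabla \<and>
             has_section_at_infinity nabla_phi nabla \<Sigma>))"
proof (intro conjI allI impI)
  have Q: "lattice_polytope nabla_phi"
    using assms by (simp add: reflexive_polytope_def)
  {
    fix nabla_s v_z v_s v_t \<Delta>
    assume asm: "semistable_polytope nabla_phi v_z v_s v_t nabla_s \<and>
        reflexive_polytope \<Delta> \<and>
        \<Delta> \<subseteq> dual_polytope nabla_s \<and>
        in_plane (dual_polytope nabla_phi) \<subseteq> \<Delta>"
    then have ss: "semistable_polytope nabla_phi v_z v_s v_t nabla_s"
      and \<Delta>: "reflexive_polytope \<Delta>" "\<Delta> \<subseteq> dual_polytope nabla_s"
        "in_plane (dual_polytope nabla_phi) \<subseteq> \<Delta>"
      by auto
    note dual = dual_polytope_semistable[OF assms ss \<Delta>]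
    show "nabla_s \<subseteq> dual_polytope \<Delta>"
      "dual_polytope \<Delta> \<inter> in_plane UNIV = in_plane nabla_phi"
      by (fact dual)+
    show refl: "reflexive_polytope (dual_polytope \<Delta>)"
      using \<Delta>(1) by (rule reflexive_polytope_dual)
    fix \<Sigma> assume "fibered_resolution (dual_polytope \<Delta>) \<Sigma>"
    then show "section_at_infinity nabla_phi (dual_polytope \<Delta>) \<Sigma> v_z"
      using refl Q dual(2-4) by (intro slice_vertex_not_extreme_imp_section_at_infinity)
  next
    fix nabla \<Sigma>
    assume asm: "reflexive_polytope nabla \<and> in_plane nabla_phi \<subseteq> nabla \<and>
        (nabla \<inter> in_plane UNIV = in_plane nabla_phi \<longrightarrow> fibered_resolution nabla \<Sigma>)"
    then have P: "lattice_polytope nabla" and QP: "in_plane nabla_phi \<subseteq> nabla"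
      by (auto simp: reflexive_polytope_def)
    have sec: "has_section_at_infinity nabla_phi nabla \<Sigma> \<longleftrightarrow> fiber_with_hidden_vertex nabla_phi nabla"
      using asm Q by (intro has_section_at_infinity_iff) auto
    show "candelas_conditions nabla_phi nabla \<longleftrightarrow>
        fst ` nabla = nabla_phi \<and> has_section_at_infinity nabla_phi nabla \<Sigma>"
      unfolding sec using P Q QP by (rule candelas_conditions_iff)
    \<comment> \<open>By invariance the hidden vertex can be tested in the original coordinates;
      only the projection condition varies with \<open>(Q', P')\<close>.\<close>
    have "candelas_conditions Q' P' \<longleftrightarrow> fst ` P' = Q' \<and> fiber_with_hidden_vertex nabla_phi nabla"
      if "lattice_equivalent nabla_phi nabla Q' P'" for Q' P'
      using candelas_conditions_iff[OF lattice_equivalent_lattice_polytopes[OF that P Q QP]]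
        lattice_equivalent_fiber_with_hidden_vertex that lattice_equivalent_sym by blast
    then show "candelas_up_to_automorphism nabla_phi nabla \<longleftrightarrow>
        projects_up_to_automorphism nabla_phi nabla \<and> has_section_at_infinity nabla_phi nabla \<Sigma>"
      unfolding sec candelas_up_to_automorphism_def projects_up_to_automorphism_def by blast
  }
qed

end
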